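(* Let $S$ be a unital inverse semigroup, let $\mathsf{A}$ be an associative $K$-algebra, and let $\alpha = (\{\alpha_s\}_{s\in S}, \{X_s\}_{s\in S})$ be a partial action of $S$ on $\mathsf{A}$ such that each ideal $X_s$ ($s\in S$) is $(L,R)$-associative. Then the algebraic crossed product $\mathsf{A}\times_\alpha S$ is associative.
   Context: $K$ is a fixed base field; algebras are $K$-algebras, not necessarily unital, and ideals are two-sided. $S$ is an inverse semigroup with identity $1$; $s^*$ denotes the inverse of $s$, and $r\le t$ is the natural partial order on $S$ ($r\le t$ iff $r=te$ for some idempotent $e\in S$). Partial action: a partial action $\alpha$ of $S$ on an associative algebra $\mathsf{A}$ consists of ideals $X_s$ of $\mathsf{A}$ ($s\in S$) and algebra isomorphisms $\alpha_s: X_{s^*}\to X_s$ such that for all $s,t\in S$: (1) $\alpha_s^{-1}=\alpha_{s^*}$; (2) $\alpha_s(X_{s^*}\cap X_t)=X_s\cap X_{st}$; (3) $\alpha_s(\alpha_t(x))=\alpha_{st}(x)$ for all $x\in X_{t^*}\cap X_{t^*s^*}$. (It follows that $X_r\subseteq X_t$ whenever $r\le t$.) Algebraic crossed product: let $L=\{\sum_{s\in S} a_s\delta_s : a_s\in X_s\}$ be the set of all formal finite sums (i.e. the direct sum of the spaces $X_s\delta_s$, with $\delta_s$ formal symbols), with the bilinear multiplication determined by $(a_s\delta_s)(b_t\delta_t)=\alpha_s(\alpha_{s^*}(a_s)b_t)\delta_{st}$ (a priori not associative). Let $I$ be the two-sided ideal of $L$ generated by $\{a\delta_r-a\delta_t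 : r\le t,\ a\in X_r\}$. Then $\mathsf{A}\times_\alpha S := L/I$. Multipliers: a multiplier of an algebra $X$ is a pair $(L,R)$ of linear maps $X\to X$ with $L(ab)=L(a)b$, $R(ab)=aR(b)$ and $R(a)b=aL(b)$ for all $a,b\in X$. The algebra $X$ is $(L,R)$-associative if $L\circ R'=R'\circ L$ for all multipliers $(L,R),(L',R')$ of $X$. *)

theory Defs
  imports Complex_Main "HOL-Library.Poly_Mapping"
begin

class inverse_monoid = monoid_mult +
  assumes ex1_star: "\<exists>!t. s * t * s = s \<and> t * s * t = t"

definition star :: "'s::inverse_monoid \<Rightarrow> 's"
  where "star s = (THE t. s * t * s = s \<and> t * s * t = t)"

definition nat_le :: "'s::inverse_monoid \<Rightarrow> 's \<Rightarrow> bool"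
  where "nat_le r t \<longleftrightarrow> (\<exists>e. e * e = e \<and> r = t * e)"

text \<open>The type class \<^class>\<open>ring\<close> provides associativity and distributivity, but no unit.\<close>

locale assoc_algebra = vector_space scale
  for scale :: "'k::field \<Rightarrow> 'a::ring \<Rightarrow> 'a" +
  assumes scale_mult_left: "scale c x * y = scale c (x * y)"
    and scale_mult_right: "x * scale c y = scale c (x * y)"

text \<open>The crossed product is built from algebras whose associativity is not known in advance; their
  multiplication is therefore passed as an explicit function \<open>m\<close> on a carrier set \<open>V\<close>.\<close>

definition is_ideal ::
  "('k::field \<Rightarrow> 'v::ab_group_add \<Rightarrow> 'v) \<Rightarrow> ('v \<Rightarrow> 'v \<Rightarrow> 'v) \<Rightarrow> 'v set \<Rightarrow> 'v set \<Rightarrow> bool"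
  where "is_ideal scale m V J \<longleftrightarrow> J \<subseteq> V \<and> module.subspace scale J \<and>
    (\<forall>x\<in>V. \<forall>j\<in>J. m x j \<in> J \<and> m j x \<in> J)"

definition ideal_generated ::
  "('k::field \<Rightarrow> 'v::ab_group_add \<Rightarrow> 'v) \<Rightarrow> ('v \<Rightarrow> 'v \<Rightarrow> 'v) \<Rightarrow> 'v set \<Rightarrow> 'v set \<Rightarrow> 'v set"
  where "ideal_generated scale m V G = \<Inter>{J. is_ideal scale m V J \<and> G \<subseteq> J}"

record ('k, 'v) nonassoc_algebra =
  carrier :: "'v set"
  azero :: "'v"
  aplus :: "'v \<Rightarrow> 'v \<Rightarrow> 'v"
  ascale :: "'k \<Rightarrow> 'v \<Rightarrow> 'v"
  amult :: "'v \<Rightarrow> 'v \<Rightarrow> 'v"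

definition associative :: "('k, 'v) nonassoc_algebra \<Rightarrow> bool"
  where "associative B \<longleftrightarrow> (\<forall>x\<in>carrier B. \<forall>y\<in>carrier B. \<forall>z\<in>carrier B.
    amult B (amult B x y) z = amult B x (amult B y z))"

definition coset :: "'v::ab_group_add set \<Rightarrow> 'v \<Rightarrow> 'v set"
  where "coset I x = (\<lambda>i. x + i) ` I"

text \<open>The operations on cosets are independent of representatives, so each union below is the coset of
  the result on any representatives; for the multiplication of the crossed product see
  \<open>amult_crossed_product_coset\<close> below.\<close>

definition quotient_algebra ::
  "('k::field \<Rightarrow> 'v::ab_group_add \<Rightarrow> 'v) \<Rightarrow> ('v \<Rightarrow> 'v \<Rightarrow> 'v) \<Rightarrow> 'v set \<Rightarrow> 'v set
    \<Rightarrow> ('k, 'v set) nonassoc_algebra"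
  where "quotient_algebra scale m V I = \<lparr>
    carrier = coset I ` V,
    azero = coset I 0,
    aplus = (\<lambda>P Q. \<Union>x\<in>P. \<Union>y\<in>Q. coset I (x + y)),
    ascale = (\<lambda>c P. \<Union>x\<in>P. coset I (scale c x)),
    amult = (\<lambda>P Q. \<Union>x\<in>P. \<Union>y\<in>Q. coset I (m x y))\<rparr>"

text \<open>Maps defined on a subspace are represented by total functions of which only the values on that
  subspace matter.\<close>

definition linear_map_on ::
  "('k::field \<Rightarrow> 'a::ring \<Rightarrow> 'a) \<Rightarrow> 'a set \<Rightarrow> 'a set \<Rightarrow> ('a \<Rightarrow> 'a) \<Rightarrow> bool"
  where "linear_map_on scale X Y f \<longleftrightarrow> (\<forall>x\<in>X. f x \<in> Y) \<and>
    (\<forall>x\<in>X. \<forall>y\<in>X. f (x + y) = f x + f y) \<and> (\<forall>c. \<forall>x\<in>X. f (scale c x) = scale c (f x))"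

definition algebra_iso_on ::
  "('k::field \<Rightarrow> 'a::ring \<Rightarrow> 'a) \<Rightarrow> 'a set \<Rightarrow> 'a set \<Rightarrow> ('a \<Rightarrow> 'a) \<Rightarrow> bool"
  where "algebra_iso_on scale X Y f \<longleftrightarrow> linear_map_on scale X Y f \<and> bij_betw f X Y \<and>
    (\<forall>x\<in>X. \<forall>y\<in>X. f (x * y) = f x * f y)"

definition multiplier ::
  "('k::field \<Rightarrow> 'a::ring \<Rightarrow> 'a) \<Rightarrow> 'a set \<Rightarrow> ('a \<Rightarrow> 'a) \<Rightarrow> ('a \<Rightarrow> 'a) \<Rightarrow> bool"
  where "multiplier scale X L R \<longleftrightarrow> linear_map_on scale X X L \<and> linear_map_on scale X X R \<and>
    (\<forall>a\<in>X. \<forall>b\<in>X. L (a * b) = L a * b \<and> R (a * b) = a * R b \<and> R a * b = a * L b)"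

definition LR_associative :: "('k::field \<Rightarrow> 'a::ring \<Rightarrow> 'a) \<Rightarrow> 'a set \<Rightarrow> bool"
  where "LR_associative scale X \<longleftrightarrow> (\<forall>L R L' R'.
    multiplier scale X L R \<and> multiplier scale X L' R' \<longrightarrow> (\<forall>x\<in>X. L (R' x) = R' (L x)))"

definition partial_action ::
  "('k::field \<Rightarrow> 'a::ring \<Rightarrow> 'a) \<Rightarrow> ('s::inverse_monoid \<Rightarrow> 'a set) \<Rightarrow> ('s \<Rightarrow> 'a \<Rightarrow> 'a) \<Rightarrow> bool"
  where "partial_action scale X \<alpha> \<longleftrightarrow>
    (\<forall>s. is_ideal scale (*) UNIV (X s)) \<and>
    (\<forall>s. algebra_iso_on scale (X (star s)) (X s) (\<alpha> s)) \<and>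
    (\<forall>s. \<forall>y\<in>X s. inv_into (X (star s)) (\<alpha> s) y = \<alpha> (star s) y) \<and>
    (\<forall>s t. \<alpha> s ` (X (star s) \<inter> X t) = X s \<inter> X (s * t)) \<and>
    (\<forall>s t. \<forall>x \<in> X (star t) \<inter> X (star t * star s). \<alpha> s (\<alpha> t x) = \<alpha> (s * t) x)"

text \<open>The formal sum of the \<open>a\<^sub>s \<delta>\<^sub>s\<close> is the finitely supported function \<open>s \<mapsto> a\<^sub>s\<close>; in particular
  \<open>a \<delta>\<^sub>s\<close> is \<open>Poly_Mapping.single s a\<close>.\<close>

definition L_carrier :: "('s \<Rightarrow> 'a::ring set) \<Rightarrow> ('s \<Rightarrow>\<^sub>0 'a) set"
  where "L_carrier X = {f. \<forall>s. Poly_Mapping.lookup f s \<in> X s}"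

definition L_scale :: "('k::field \<Rightarrow> 'a::ring \<Rightarrow> 'a) \<Rightarrow> 'k \<Rightarrow> ('s \<Rightarrow>\<^sub>0 'a) \<Rightarrow> ('s \<Rightarrow>\<^sub>0 'a)"
  where "L_scale scale c f = Poly_Mapping.map (scale c) f"

definition L_mult ::
  "('s::inverse_monoid \<Rightarrow> 'a::ring \<Rightarrow> 'a) \<Rightarrow> ('s \<Rightarrow>\<^sub>0 'a) \<Rightarrow> ('s \<Rightarrow>\<^sub>0 'a) \<Rightarrow> ('s \<Rightarrow>\<^sub>0 'a)"
  where "L_mult \<alpha> f g = (\<Sum>s\<in>Poly_Mapping.keys f. \<Sum>t\<in>Poly_Mapping.keys g.
    Poly_Mapping.single (s * t) (\<alpha> s (\<alpha> (star s) (Poly_Mapping.lookup f s) * Poly_Mapping.lookup g t)))"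

definition crossed_ideal ::
  "('k::field \<Rightarrow> 'a::ring \<Rightarrow> 'a) \<Rightarrow> ('s::inverse_monoid \<Rightarrow> 'a set) \<Rightarrow> ('s \<Rightarrow> 'a \<Rightarrow> 'a)
    \<Rightarrow> ('s \<Rightarrow>\<^sub>0 'a) set"
  where "crossed_ideal scale X \<alpha> =
    ideal_generated (L_scale scale) (L_mult \<alpha>) (L_carrier X)
      {Poly_Mapping.single r a - Poly_Mapping.single t a | r t a. nat_le r t \<and> a \<in> X r}"

definition crossed_product ::
  "('k::field \<Rightarrow> 'a::ring \<Rightarrow> 'a) \<Rightarrow> ('s::inverse_monoid \<Rightarrow> 'a set) \<Rightarrow> ('s \<Rightarrow> 'a \<Rightarrow> 'a)
    \<Rightarrow> ('k, ('s \<Rightarrow>\<^sub>0 'a) set) nonassoc_algebra"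
  where "crossed_product scale X \<alpha> =
    quotient_algebra (L_scale scale) (L_mult \<alpha>) (L_carrier X) (crossed_ideal scale X \<alpha>)"

lemma star_props: "(s::'s::inverse_monoid) * star s * s = s" "star s * s * star s = star s"
  using theI'[OF ex1_star[of s]] unfolding star_def by auto

lemma star_unique: "(s::'s::inverse_monoid) * t * s = s \<Longrightarrow> t * s * t = t \<Longrightarrow> star s = t"
  using ex1_star[of s] star_props[of s] by blast

lemma star_star [simp]: "star (star s) = (s::'s::inverse_monoid)"
  by (rule star_unique) (simp_all add: star_props)

lemma star_idem: "e * e = e \<Longrightarrow> star e = (e::'s::inverse_monoid)"
  by (rule star_unique) simp_all

lemma range_idem: "(s * star s) * (s * star s) = s * star (s::'s::inverse_monoid)"
  using star_props(1)[of s] by (simp add: mult.assoc[symmetric])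

lemma idem_mult:
  fixes e f :: "'s::inverse_monoid"
  assumes "e * e = e" "f * f = f"
  shows "(e * f) * (e * f) = e * f"
proof -
  let ?x = "star (e * f)"
  have ee: "e * (e * z) = e * z" and ff: "f * (f * z) = f * z" for z
    using assms by (simp_all add: mult.assoc[symmetric])
  have x1: "e * (f * (?x * (e * f))) = e * f" and x2: "?x * (e * (f * ?x)) = ?x"
    using star_props[of "e * f"] by (simp_all add: mult.assoc)
  have x2': "?x * (e * (f * (?x * z))) = ?x * z" for z
    using x2 by (metis mult.assoc)
  have "?x = f * ?x * e"
    by (rule star_unique) (simp_all add: mult.assoc ee ff x1 x2')
  then have "?x * ?x = ?x"
    by (metis mult.assoc x2')
  then have "star ?x = ?x" by (rule star_idem)
  then show ?thesis using \<open>?x * ?x = ?x\<close> by simp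
qed

lemma idem_commute:
  fixes e f :: "'s::inverse_monoid"
  assumes e: "e * e = e" and f: "f * f = f"
  shows "e * f = f * e"
proof -
  have ee: "e * (e * z) = e * z" and ff: "f * (f * z) = f * z" for z
    using assms by (simp_all add: mult.assoc[symmetric])
  have "star (e * f) = f * e"
    using idem_mult[OF e f] idem_mult[OF f e]
    by (intro star_unique) (simp_all add: mult.assoc ee ff)
  then show ?thesis using star_idem[OF idem_mult[OF e f]] by simp
qed

lemma nat_le_range:
  fixes r t :: "'s::inverse_monoid"
  assumes "nat_le r t"
  shows "r * star r * t = r"
proof -
  obtain e where e: "e * e = e" "r = t * e" using assms by (auto simp: nat_le_def)
  have c: "star t * t * e = e * (star t * t)"
    using range_idem[of "star t"] e(1) by (intro idem_commute) simp_all
  have ee: "e * (e * z) = e * z" for z using e by (simp add: mult.assoc[symmetric])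
  have t: "t * (star t * (t * z)) = t * z" "star t * (t * (star t * z)) = star t * z" for z
    using star_props[of t] by (simp_all add: mult.assoc[symmetric])
  have c': "e * (star t * (t * z)) = star t * (t * (e * z))" for z
    using c by (metis mult.assoc)
  have c'': "e * (star t * t) = star t * (t * e)" using c by (simp add: mult.assoc)
  have d: "star t * (t * (e * star t)) = e * star t"
    using c'[of "star t"] star_props(2)[of t] by (simp add: mult.assoc)
  have "star (t * e) = e * star t"
    by (rule star_unique) (simp_all add: mult.assoc ee c' c'' t d e)
  then show ?thesis using e by (simp add: mult.assoc ee c' c'' t d)
qed

context
  fixes scale :: "'k::field \<Rightarrow> 'a::ring \<Rightarrow> 'a"
    and X :: "'s::inverse_monoid \<Rightarrow> 'a set"
    and \<alpha> :: "'s \<Rightarrow> 'a \<Rightarrow> 'a"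
  assumes A: "assoc_algebra scale" and pa: "partial_action scale X \<alpha>"
begin

interpretation assoc_algebra scale by (rule A)

lemma X_subspace: "subspace (X s)"
  using pa by (auto simp: partial_action_def is_ideal_def)

lemma X_0: "0 \<in> X s"
  by (rule subspace_0[OF X_subspace])

lemma X_mult: "x \<in> X s \<Longrightarrow> x * y \<in> X s" "x \<in> X s \<Longrightarrow> y * x \<in> X s"
  using pa by (auto simp: partial_action_def is_ideal_def)

lemma \<alpha>_closed: "x \<in> X (star s) \<Longrightarrow> \<alpha> s x \<in> X s"
  using pa by (auto simp: partial_action_def algebra_iso_on_def linear_map_on_def)

lemma \<alpha>_star_closed: "x \<in> X s \<Longrightarrow> \<alpha> (star s) x \<in> X (star s)"
  using \<alpha>_closed[of x "star s"] by simp

lemma \<alpha>_add: "x \<in> X (star s) \<Longrightarrow> y \<in> X (star s) \<Longrightarrow> \<alpha> s (x + y) = \<alpha> s x + \<alpha> s y"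
  using pa by (auto simp: partial_action_def algebra_iso_on_def linear_map_on_def)

lemma \<alpha>_0: "\<alpha> s 0 = 0"
  using \<alpha>_add[OF X_0 X_0, of s] by simp

definition L_term :: "('s \<Rightarrow>\<^sub>0 'a) \<Rightarrow> ('s \<Rightarrow>\<^sub>0 'a) \<Rightarrow> 's \<Rightarrow> 's \<Rightarrow> 's \<Rightarrow>\<^sub>0 'a"
  where "L_term f g s t =
    Poly_Mapping.single (s * t) (\<alpha> s (\<alpha> (star s) (Poly_Mapping.lookup f s) * Poly_Mapping.lookup g t))"

lemma L_mult_superset:
  assumes "finite S" "finite T" "Poly_Mapping.keys f \<subseteq> S" "Poly_Mapping.keys g \<subseteq> T"
  shows "L_mult \<alpha> f g = (\<Sum>s\<in>S. \<Sum>t\<in>T. L_term f g s t)"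
proof -
  have z: "L_term f g s t = 0" if "s \<notin> Poly_Mapping.keys f \<or> t \<notin> Poly_Mapping.keys g" for s t
    using that by (auto simp: L_term_def in_keys_iff \<alpha>_0)
  have "(\<Sum>s\<in>S. \<Sum>t\<in>T. L_term f g s t) = (\<Sum>s\<in>S. \<Sum>t\<in>Poly_Mapping.keys g. L_term f g s t)"
    using assms z by (intro sum.cong refl sum.mono_neutral_right) auto
  also have "\<dots> = (\<Sum>s\<in>Poly_Mapping.keys f. \<Sum>t\<in>Poly_Mapping.keys g. L_term f g s t)"
    using assms z by (intro sum.mono_neutral_right) auto
  finally show ?thesis by (simp add: L_mult_def L_term_def)
qed

lemma L_mult_add_left:
  assumes "f \<in> L_carrier X" "f' \<in> L_carrier X"
  shows "L_mult \<alpha> (f + f') g = L_mult \<alpha> f g + L_mult \<alpha> f' g"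
proof -
  let ?S = "Poly_Mapping.keys f \<union> Poly_Mapping.keys f'"
  have t: "L_term (f + f') g s t = L_term f g s t + L_term f' g s t" for s t
    using assms
    by (simp add: L_term_def L_carrier_def lookup_add \<alpha>_add \<alpha>_star_closed X_mult
        distrib_right single_add)
  show ?thesis
    by (simp add: L_mult_superset[of ?S "Poly_Mapping.keys g"] keys_add t sum.distrib)
qed

lemma L_mult_add_right:
  assumes "f \<in> L_carrier X"
  shows "L_mult \<alpha> f (g + g') = L_mult \<alpha> f g + L_mult \<alpha> f g'"
proof -
  let ?T = "Poly_Mapping.keys g \<union> Poly_Mapping.keys g'"
  have t: "L_term f (g + g') s t = L_term f g s t + L_term f g' s t" for s t
    using assms
    by (simp add: L_term_def L_carrier_def lookup_add \<alpha>_add \<alpha>_star_closed X_mult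
        distrib_left single_add)
  show ?thesis
    by (simp add: L_mult_superset[of "Poly_Mapping.keys f" ?T] keys_add t sum.distrib)
qed

lemma lookup_L_scale: "Poly_Mapping.lookup (L_scale scale c f) s = scale c (Poly_Mapping.lookup f s)"
  by (simp add: L_scale_def Poly_Mapping.map.rep_eq when_def)

lemma module_L_scale: "module (L_scale scale :: 'k \<Rightarrow> ('s \<Rightarrow>\<^sub>0 'a) \<Rightarrow> ('s \<Rightarrow>\<^sub>0 'a))"
  by unfold_locales
    (auto intro!: poly_mapping_eqI
      simp: lookup_L_scale lookup_add scale_right_distrib scale_left_distrib)

lemma L_mult_closed:
  assumes "f \<in> L_carrier X" "g \<in> L_carrier X"
  shows "L_mult \<alpha> f g \<in> L_carrier X"
proof -
  have "\<alpha> s (\<alpha> (star s) (Poly_Mapping.lookup f s) * Poly_Mapping.lookup g t) \<in> X (s * t)" for s t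
  proof -
    have "\<alpha> s ` (X (star s) \<inter> X t) = X s \<inter> X (s * t)"
      using pa by (simp add: partial_action_def)
    moreover have "\<alpha> (star s) (Poly_Mapping.lookup f s) * Poly_Mapping.lookup g t \<in> X (star s) \<inter> X t"
      using assms by (simp add: L_carrier_def \<alpha>_star_closed X_mult)
    ultimately show ?thesis by blast
  qed
  then show ?thesis
    by (auto simp: L_mult_def L_carrier_def lookup_sum lookup_single when_def X_0
        intro!: subspace_sum[OF X_subspace])
qed

lemma \<alpha>_image: "\<alpha> s ` (X (star s) \<inter> X t) = X s \<inter> X (s * t)"
  using pa by (simp add: partial_action_def)

lemma X_subset_range: "X s \<subseteq> X (s * star s)"
proof -
  have "\<alpha> s ` X (star s) = X s"
    using pa by (simp add: partial_action_def algebra_iso_on_def bij_betw_def)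
  then show ?thesis using \<alpha>_image[of s "star s"] by auto
qed

lemma \<alpha>_idem:
  assumes e: "e * e = e" and x: "x \<in> X e"
  shows "\<alpha> e x = x"
proof -
  have se: "star e = e" by (rule star_idem[OF e])
  have "\<forall>x \<in> X (star e) \<inter> X (star e * star e). \<alpha> e (\<alpha> e x) = \<alpha> (e * e) x"
    using pa unfolding partial_action_def by blast
  then have "\<alpha> e (\<alpha> e x) = \<alpha> e x" using e x by (simp add: se)
  moreover have "bij_betw (\<alpha> e) (X (star e)) (X e)"
    using pa by (simp add: partial_action_def algebra_iso_on_def)
  then have "inj_on (\<alpha> e) (X e)"
    by (simp add: se bij_betw_def)
  ultimately show ?thesis
    using \<alpha>_closed[of x e] x se by (auto dest: inj_onD)
qed

lemma X_mono:
  assumes "nat_le r t"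
  shows "X r \<subseteq> X t"
proof -
  let ?f = "r * star r"
  have f: "?f * ?f = ?f" by (rule range_idem)
  have "\<alpha> ?f ` (X ?f \<inter> X t) = X ?f \<inter> X (?f * t)"
    using \<alpha>_image[of ?f t] by (simp add: star_idem[OF f])
  moreover have "\<alpha> ?f ` (X ?f \<inter> X t) = (\<lambda>x. x) ` (X ?f \<inter> X t)"
    by (rule image_cong) (auto simp: \<alpha>_idem[OF f])
  moreover have "?f * t = r" using assms by (rule nat_le_range)
  ultimately show ?thesis using X_subset_range[of r] by auto
qed

lemma is_ideal_crossed_ideal:
  "is_ideal (L_scale scale) (L_mult \<alpha>) (L_carrier X) (crossed_ideal scale X \<alpha>)"
proof -
  interpret L: module "L_scale scale :: 'k \<Rightarrow> ('s \<Rightarrow>\<^sub>0 'a) \<Rightarrow> ('s \<Rightarrow>\<^sub>0 'a)"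
    by (rule module_L_scale)
  let ?G = "{Poly_Mapping.single r a - Poly_Mapping.single t a | r t a. nat_le r t \<and> a \<in> X r}"
  let ?J = "{J. is_ideal (L_scale scale) (L_mult \<alpha>) (L_carrier X) J \<and> ?G \<subseteq> J}"
  have "L.subspace (L_carrier X)"
    by (rule L.subspaceI)
      (auto simp: L_carrier_def lookup_add lookup_L_scale X_0
        intro: subspace_add[OF X_subspace] subspace_scale[OF X_subspace])
  then have "is_ideal (L_scale scale) (L_mult \<alpha>) (L_carrier X) (L_carrier X)"
    by (auto simp: is_ideal_def L_mult_closed)
  moreover have "?G \<subseteq> L_carrier X"
    by (auto simp: L_carrier_def lookup_minus lookup_single when_def X_0
        intro!: subspace_diff[OF X_subspace] subspace_neg[OF X_subspace]
        elim: X_mono[THEN subsetD])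
  ultimately have V: "L_carrier X \<in> ?J" by blast
  have "L.subspace (\<Inter>?J)"
    by (rule L.subspace_Inter) (auto simp: is_ideal_def)
  then show ?thesis
    using V unfolding crossed_ideal_def ideal_generated_def
    by (auto simp: is_ideal_def)
qed

lemma amult_crossed_product_coset:
  assumes f: "f \<in> L_carrier X" and g: "g \<in> L_carrier X"
  defines "I \<equiv> crossed_ideal scale X \<alpha>"
  shows "amult (crossed_product scale X \<alpha>) (coset I f) (coset I g) = coset I (L_mult \<alpha> f g)"
proof -
  interpret L: module "L_scale scale :: 'k \<Rightarrow> ('s \<Rightarrow>\<^sub>0 'a) \<Rightarrow> ('s \<Rightarrow>\<^sub>0 'a)"
    by (rule module_L_scale)
  have idl: "I \<subseteq> L_carrier X" "L.subspace I"
    and m: "\<And>x j. x \<in> L_carrier X \<Longrightarrow> j \<in> I \<Longrightarrow> L_mult \<alpha> x j \<in> I \<and> L_mult \<alpha> j x \<in> I"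
    using is_ideal_crossed_ideal by (auto simp: is_ideal_def I_def)
  have shift: "coset I (x + i) = coset I x" if "i \<in> I" for x i
  proof -
    have "(+) i ` I = I"
    proof
      show "(+) i ` I \<subseteq> I"
        using L.subspace_add[OF idl(2) that] by blast
      show "I \<subseteq> (+) i ` I"
      proof
        fix j assume "j \<in> I"
        then have "j - i \<in> I" using L.subspace_diff[OF idl(2)] that by blast
        then show "j \<in> (+) i ` I" by (rule rev_image_eqI) simp
      qed
    qed
    then have "(+) x ` ((+) i ` I) = (+) x ` I" by simp
    then show ?thesis by (simp add: coset_def image_image add.assoc)
  qed
  have "coset I (L_mult \<alpha> (f + i) (g + j)) = coset I (L_mult \<alpha> f g)" if "i \<in> I" "j \<in> I" for i j
  proof -
    have iL: "i \<in> L_carrier X" "j \<in> L_carrier X" using that idl by auto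
    have "L_mult \<alpha> (f + i) (g + j) =
        L_mult \<alpha> f g + (L_mult \<alpha> f j + (L_mult \<alpha> i g + L_mult \<alpha> i j))"
      using f g iL by (simp add: L_mult_add_left L_mult_add_right add.assoc)
    moreover have "L_mult \<alpha> f j + (L_mult \<alpha> i g + L_mult \<alpha> i j) \<in> I"
      using m f g iL that by (intro L.subspace_add[OF idl(2)]) auto
    ultimately show ?thesis using shift by simp
  qed
  moreover have "I \<noteq> {}" using L.subspace_0[OF idl(2)] by blast
  moreover have "amult (crossed_product scale X \<alpha>) (coset I f) (coset I g) =
      (\<Union>i\<in>I. \<Union>j\<in>I. coset I (L_mult \<alpha> (f + i) (g + j)))"
    by (simp add: crossed_product_def quotient_algebra_def I_def[symmetric] coset_def)
  ultimately show ?thesis by simp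
qed

end

end

theory Submission
  imports Defs
begin

text \<open>The algebra \<open>L\<close> is already associative. On the relevant elements
  \<open>\<alpha>\<^bsub>(st)*\<^esub> \<circ> \<alpha>\<^sub>s = \<alpha>\<^bsub>t*\<^esub>\<close> and \<open>\<alpha>\<^bsub>st\<^esub> = \<alpha>\<^sub>s \<circ> \<alpha>\<^sub>t\<close>, so both bracketings of
  \<open>a\<delta>\<^sub>s \<cdot> b\<delta>\<^sub>t \<cdot> c\<delta>\<^sub>u\<close> have a coefficient of the form \<open>\<alpha>\<^sub>s(_)\<close>, and with \<open>a' = \<alpha>\<^bsub>s*\<^esub>(a)\<close> it
  remains to see that \<open>\<alpha>\<^sub>t(\<alpha>\<^bsub>t*\<^esub>(a'b)c) = a' \<alpha>\<^sub>t(\<alpha>\<^bsub>t*\<^esub>(b)c)\<close>. This says that on \<open>X\<^sub>t\<close> the left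
  multiplication by \<open>a'\<close> commutes with the right multiplication by \<open>c\<close> on \<open>X\<^bsub>t*\<^esub>\<close> transported along
  \<open>\<alpha>\<^sub>t\<close>. Both are components of multipliers of \<open>X\<^sub>t\<close>, so they commute by
  \<open>(L,R)\<close>-associativity.\<close>

text \<open>The idempotents \<open>t * star t\<close> and \<open>star s * s\<close> commute;
  swapping them inside either product regroups it into the defining identities of
  \<open>star s\<close> and \<open>star t\<close>.\<close>

lemma star_mult: "star (s * t) = star t * star (s::'s::inverse_monoid)"
proof -
  have c: "t * star t * (star s * s) = star s * s * (t * star t)"
    using range_idem[of t] range_idem[of "star s"] by (intro idem_commute) simp_all
  have 1: "s * t * (star t * star s) * (s * t) = s * (t * star t * (star s * s)) * t"
    by (simp only: mult.assoc)
  have 2: "star t * star s * (s * t) * (star t * star s)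
      = star t * (star s * s * (t * star t)) * star s"
    by (simp only: mult.assoc)
  have "s * (t * star t * (star s * s)) * t = (s * star s * s) * (t * star t * t)"
    unfolding c by (simp only: mult.assoc)
  moreover have "star t * (star s * s * (t * star t)) * star s
      = (star t * t * star t) * (star s * s * star s)"
    unfolding c[symmetric] by (simp only: mult.assoc)
  ultimately show ?thesis
    using 1 2 by (intro star_unique) (simp_all add: star_props)
qed

lemma poly_mapping_sum_singles:
  "f = (\<Sum>k\<in>Poly_Mapping.keys f. Poly_Mapping.single k (Poly_Mapping.lookup f k))"
  by (rule poly_mapping_eqI)
    (auto simp: lookup_sum lookup_single when_def in_keys_iff)

context
  fixes scale :: "'k::field \<Rightarrow> 'a::ring \<Rightarrow> 'a"
    and X :: "'s::inverse_monoid \<Rightarrow> 'a set"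
    and \<alpha> :: "'s \<Rightarrow> 'a \<Rightarrow> 'a"
  assumes A: "assoc_algebra scale" and pa: "partial_action scale X \<alpha>"
begin

interpretation assoc_algebra scale by (rule A)

lemma \<alpha>_scale: "x \<in> X (star s) \<Longrightarrow> \<alpha> s (scale c x) = scale c (\<alpha> s x)"
  using pa by (auto simp: partial_action_def algebra_iso_on_def linear_map_on_def)

lemma \<alpha>_mult: "x \<in> X (star s) \<Longrightarrow> y \<in> X (star s) \<Longrightarrow> \<alpha> s (x * y) = \<alpha> s x * \<alpha> s y"
  using pa by (auto simp: partial_action_def algebra_iso_on_def)

lemma \<alpha>_star_\<alpha>:
  assumes "x \<in> X (star s)"
  shows "\<alpha> (star s) (\<alpha> s x) = x"
proof -
  have "inj_on (\<alpha> s) (X (star s))"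
    using pa by (auto simp: partial_action_def algebra_iso_on_def bij_betw_def)
  then have "inv_into (X (star s)) (\<alpha> s) (\<alpha> s x) = x"
    using assms by (rule inv_into_f_f)
  moreover have "inv_into (X (star s)) (\<alpha> s) (\<alpha> s x) = \<alpha> (star s) (\<alpha> s x)"
    using pa \<alpha>_closed[OF A pa assms] unfolding partial_action_def by blast
  ultimately show ?thesis by simp
qed

lemma \<alpha>_\<alpha>_star: "x \<in> X s \<Longrightarrow> \<alpha> s (\<alpha> (star s) x) = x"
  using \<alpha>_star_\<alpha>[of x "star s"] by simp

lemma \<alpha>_comp: "x \<in> X (star t) \<Longrightarrow> x \<in> X (star t * star s) \<Longrightarrow> \<alpha> s (\<alpha> t x) = \<alpha> (s * t) x"
  using pa unfolding partial_action_def by blast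

text \<open>Both sides equal the action of \<open>star t * e\<close> on \<open>x\<close>, where the
  idempotent \<open>e = star s * s\<close> fixes \<open>x\<close>.\<close>

lemma \<alpha>_star_mult_\<alpha>:
  assumes x: "x \<in> X (star s)" "x \<in> X t"
  shows "\<alpha> (star (s * t)) (\<alpha> s x) = \<alpha> (star t) x"
proof -
  define e where "e = star s * s"
  have e: "e * e = e" using range_idem[of "star s"] by (simp add: e_def)
  have se: "star e = e" using e by (rule star_idem)
  have xe: "x \<in> X e" using X_subset_range[OF A pa, of "star s"] x by (auto simp: e_def)
  have ax: "\<alpha> e x = x" using \<alpha>_idem[OF A pa e xe] .
  have "\<alpha> e ` (X (star e) \<inter> X t) = X e \<inter> X (e * t)"
    by (rule \<alpha>_image[OF A pa])
  \<comment> \<open>As \<open>\<alpha> e\<close> fixes \<open>x\<close>, the image formula puts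
    \<open>x\<close> itself in \<open>X (e * t)\<close>. This is the domain condition for both
    compositions below.\<close>
  then have xet: "x \<in> X (e * t)"
    using ax xe x by (metis IntD2 IntI imageI se)
  have "\<alpha> (star t * star s) (\<alpha> s x) = \<alpha> (star t * star s * s) x"
    using x xet by (intro \<alpha>_comp) (simp_all add: star_mult e_def mult.assoc)
  moreover have "\<alpha> (star t) (\<alpha> e x) = \<alpha> (star t * e) x"
    using xe xet by (intro \<alpha>_comp) (simp_all add: se)
  ultimately show ?thesis using ax by (simp add: star_mult e_def mult.assoc)
qed

lemma multiplier_mult: "multiplier scale (X s) (\<lambda>x. a * x) (\<lambda>x. x * a)"
  by (auto simp: multiplier_def linear_map_on_def X_mult[OF A pa] mult.assoc
      distrib_left distrib_right scale_mult_left scale_mult_right)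

text \<open>This is multiplication by \<open>c\<close> on the ideal \<open>X (star t)\<close>,
  conjugated by the isomorphism \<open>\<alpha> t\<close>. The element \<open>c\<close> need not lie
  in that ideal.\<close>

lemma multiplier_transport:
  "multiplier scale (X t) (\<lambda>x. \<alpha> t (c * \<alpha> (star t) x)) (\<lambda>x. \<alpha> t (\<alpha> (star t) x * c))"
proof -
  note closed = \<alpha>_closed[OF A pa] \<alpha>_star_closed[OF A pa] X_mult[OF A pa]
  note add = \<alpha>_add[OF A pa] \<alpha>_add[OF A pa, of _ "star t" for t, simplified]
  note sc = \<alpha>_scale \<alpha>_scale[of _ "star t" for t, simplified]
  note mul = \<alpha>_mult[of _ "star t" for t, simplified]
  have m: "x * \<alpha> t y = \<alpha> t (\<alpha> (star t) x * y)" "\<alpha> t y * x = \<alpha> t (y * \<alpha> (star t) x)"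
    if "x \<in> X t" "y \<in> X (star t)" for x y
    using that by (simp_all add: \<alpha>_mult \<alpha>_\<alpha>_star closed)
  show ?thesis
    by (auto simp: multiplier_def linear_map_on_def closed add sc mul m
        distrib_left distrib_right scale_mult_left scale_mult_right mult.assoc)
qed

text \<open>The left component of \<open>multiplier_mult\<close> and the right component of
  \<open>multiplier_transport\<close> commute at \<open>b\<close>.\<close>

lemma \<alpha>_mult_assoc:
  assumes "LR_associative scale (X t)" and b: "b \<in> X t"
  shows "\<alpha> t (\<alpha> (star t) (a * b) * c) = a * \<alpha> t (\<alpha> (star t) b * c)"
  using assms multiplier_mult multiplier_transport unfolding LR_associative_def by metis

lemma L_mult_single:
  "L_mult \<alpha> (Poly_Mapping.single s a) (Poly_Mapping.single t b)
    = Poly_Mapping.single (s * t) (\<alpha> s (\<alpha> (star s) a * b))"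
  by (subst L_mult_superset[OF A pa, of "{s}" "{t}"]) (auto simp: L_term_def[OF A pa])

lemma L_mult_single_assoc:
  assumes "LR_associative scale (X t)" and a: "a \<in> X s" and b: "b \<in> X t"
  shows "L_mult \<alpha> (L_mult \<alpha> (Poly_Mapping.single s a) (Poly_Mapping.single t b)) (Poly_Mapping.single u c)
    = L_mult \<alpha> (Poly_Mapping.single s a) (L_mult \<alpha> (Poly_Mapping.single t b) (Poly_Mapping.single u c))"
proof -
  define a' where "a' = \<alpha> (star s) a"
  have a': "a' \<in> X (star s)" using \<alpha>_star_closed[OF A pa a] by (simp add: a'_def)
  have ab: "a' * b \<in> X (star s)" "a' * b \<in> X t"
    using a' b by (simp_all add: X_mult[OF A pa])
  define y where "y = \<alpha> (star t) (a' * b) * c"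
  \<comment> \<open>Membership in the second ideal is what allows \<open>\<alpha> s\<close> and
    \<open>\<alpha> t\<close> to be composed at \<open>y\<close>; multiplying by \<open>c\<close>
    stays inside both ideals.\<close>
  have "\<alpha> (star t) (a' * b) \<in> X (star t) \<inter> X (star t * star s)"
    using \<alpha>_image[OF A pa, of "star t" "star s"] ab by auto
  then have y: "y \<in> X (star t)" "y \<in> X (star t * star s)"
    by (simp_all add: y_def X_mult[OF A pa])
  have "\<alpha> (s * t) (\<alpha> (star (s * t)) (\<alpha> s (a' * b)) * c) = \<alpha> s (\<alpha> t y)"
    using \<alpha>_comp[OF y] by (simp add: \<alpha>_star_mult_\<alpha>[OF ab] y_def)
  also have "\<alpha> t y = a' * \<alpha> t (\<alpha> (star t) b * c)"
    unfolding y_def using assms(1) b by (rule \<alpha>_mult_assoc)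
  finally show ?thesis by (simp add: L_mult_single a'_def mult.assoc)
qed

text \<open>Reduces statements about formal sums to monomials. The \<open>add\<close> case supplies
  membership because additivity of \<open>L_mult\<close> in its left factor requires it.\<close>

lemma L_carrier_induct [consumes 1, case_names zero add single]:
  assumes f: "f \<in> L_carrier X"
    and zero: "P 0"
    and add: "\<And>f g. f \<in> L_carrier X \<Longrightarrow> g \<in> L_carrier X \<Longrightarrow> P f \<Longrightarrow> P g \<Longrightarrow> P (f + g)"
    and single: "\<And>s a. a \<in> X s \<Longrightarrow> P (Poly_Mapping.single s a)"
  shows "P f"
proof -
  let ?g = "\<lambda>k. Poly_Mapping.single k (Poly_Mapping.lookup f k)"
  have X: "Poly_Mapping.lookup f k \<in> X k" for k using f by (simp add: L_carrier_def)
  have g: "?g k \<in> L_carrier X" for k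
    using X by (auto simp: L_carrier_def lookup_single when_def X_0[OF A pa])
  have "sum ?g K \<in> L_carrier X \<and> P (sum ?g K)" if "finite K" for K
    using that
  proof induction
    case empty
    then show ?case using zero by (simp add: L_carrier_def X_0[OF A pa])
  next
    case (insert k K)
    have "?g k + sum ?g K \<in> L_carrier X"
      using g[of k] insert.IH
      by (auto simp: L_carrier_def lookup_add intro: subspace_add[OF X_subspace[OF A pa]])
    then show ?case using insert add g single X by simp
  qed
  then have "P (sum ?g (Poly_Mapping.keys f))" by simp
  then show ?thesis by (simp only: poly_mapping_sum_singles[symmetric])
qed

lemma L_mult_assoc:
  assumes LR: "\<And>s. LR_associative scale (X s)"
    and f: "f \<in> L_carrier X" and g: "g \<in> L_carrier X" and h: "h \<in> L_carrier X"
  shows "L_mult \<alpha> (L_mult \<alpha> f g) h = L_mult \<alpha> f (L_mult \<alpha> g h)"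
proof -
  note bilin = L_mult_add_left[OF A pa] L_mult_add_right[OF A pa] L_mult_closed[OF A pa]
  have z: "L_mult \<alpha> 0 k = 0" "L_mult \<alpha> k 0 = 0" for k
    by (simp_all add: L_mult_def)
  have monomial: "Poly_Mapping.single s a \<in> L_carrier X" if "a \<in> X s" for s a
    using that by (auto simp: L_carrier_def lookup_single when_def X_0[OF A pa])
  \<comment> \<open>Both bracketings are additive in each factor, so \<open>f\<close>,
    \<open>g\<close> and \<open>h\<close> are replaced by monomials one after the other.\<close>
  from f show ?thesis
  proof (induction rule: L_carrier_induct)
    case (single s a)
    note sa = this
    from g show ?case
    proof (induction rule: L_carrier_induct)
      case (single t b)
      note tb = this
      from h show ?case
      proof (induction rule: L_carrier_induct)
        case (single u c)
        show ?case using LR sa tb by (rule L_mult_single_assoc)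
      qed (simp_all add: z bilin monomial sa tb)
    qed (simp_all add: z bilin h monomial sa)
  qed (simp_all add: z bilin g h)
qed

end

theorem theorem1p1:
  fixes scale :: "'k::field \<Rightarrow> 'a::ring \<Rightarrow> 'a"
    and X :: "'s::inverse_monoid \<Rightarrow> 'a set"
    and \<alpha> :: "'s \<Rightarrow> 'a \<Rightarrow> 'a"
  assumes "assoc_algebra scale"
    and "partial_action scale X \<alpha>"
    and "\<And>s. LR_associative scale (X s)"
  shows "associative (crossed_product scale X \<alpha>)"
proof -
  have "carrier (crossed_product scale X \<alpha>) = coset (crossed_ideal scale X \<alpha>) ` L_carrier X"
    by (simp add: crossed_product_def quotient_algebra_def)
  then show ?thesis
    \<comment> \<open>Cosets multiply through representatives, so associativity passes from
      \<open>L\<close> to its quotient.\<close>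
    by (auto simp: associative_def amult_crossed_product_coset[OF assms(1,2)]
        L_mult_closed[OF assms(1,2)] L_mult_assoc[OF assms])
qed

end
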